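(* Let $N=(S,T,F,M_0)$ be a net with countably many transitions that is binary-conflict-free. Then $N$ has a $\sqsubseteq_0^\infty$-largest FS-process, i.e. there is $\rho\in\mathrm{FS}^\infty(N)$ such that $\sigma\sqsubseteq_0^\infty\rho$ for every $\sigma\in\mathrm{FS}^\infty(N)$.
   Context: A net is $N=(S,T,F,M_0)$ with $S,T$ disjoint, $F:(S\times T)\cup(T\times S)\to\mathbb{N}$, $M_0:S\to\mathbb{N}$, such that every transition $t$ has a finite non-empty set of places $s$ with $F(s,t)>0$ and a finite set of places $s$ with $F(t,s)>0$. For $x\in S\cup T$, ${}^\bullet x(y)=F(y,x)$, $x^\bullet(y)=F(x,y)$ (multisets), extended additively to finite multisets $G$ of transitions. For markings $M,M':S\to\mathbb N$ and finite non-empty multiset $G$ of transitions, $M\xrightarrow{G}M'$ iff ${}^\bullet G\le M$ pointwise and $M'=(M-{}^\bullet G)+G^\bullet$ (truncated subtraction). For a finite or infinite word $\sigma=t_1t_2\cdots$ over $T$, $M\xrightarrow{\sigma}$ means $M\xrightarrow{\{t_1\}}M_1\xrightarrow{\{t_2\}}\cdots$ for some markings. $\mathrm{FS}^\infty(N)$ is the set of words $\sigma$ with $M_0\xrightarrow{\sigma}$, $\mathrm{FS}(N)$ the finite ones; a marking $M$ is reachable if $M_0\xrightarrow{\sigma}M$ for some $\sigma\in\mathrm{FS}(N)$. A finite non-empty multiset $G$ of transitions is in (semantic) conflict in $M$ iff not $M\xrightarrow{G}$ but $M\xrightarrow{G\restriction\{t\}}$ for every $t\in G$ (where $G\restriction\{t\}$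 is the multiset with $t$ occurring $G(t)$ times). $N$ is binary-conflict-free iff no multiset $G$ with $|G|=2$ is in semantic conflict in any reachable marking. $\sigma\le\rho$ means $\sigma$ is a prefix of $\rho$. $\sigma\equiv_0\rho$ (adjacent) iff $\sigma=\sigma_1tu\sigma_2$, $\rho=\sigma_1ut\sigma_2$ are firing sequences and $M_0\xrightarrow{\sigma_1}M\xrightarrow{\{t,u\}}$ for some $M$; $\equiv_0^*$ is its reflexive transitive closure. For $\sigma,\rho\in\mathrm{FS}^\infty(N)$, $\sigma\sqsubseteq_0^\infty\rho$ iff for every $\sigma''\in\mathrm{FS}(N)$ with $\sigma''\le\sigma$ there are $\sigma',\rho'\in\mathrm{FS}(N)$ with $\sigma''\le\sigma'\equiv_0^*\rho'\le\rho$. An FS-process is an equivalence class of $\mathrm{FS}^\infty(N)$ under the kernel $\equiv_0^\infty$ of the preorder $\sqsubseteq_0^\infty$; $\sqsubseteq_0^\infty$ induces a partial order on FS-processes. *)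

theory Defs
  imports "HOL-Library.Multiset" "HOL-Library.Sublist" "HOL-Library.Stream"
    "HOL-Library.Countable_Set"
begin

text \<open>
  Functions on \<open>(S \<times> T) \<union> (T \<times> S)\<close> and on \<open>S\<close> are represented by total functions on the
  ambient type that vanish outside the respective domain.
\<close>

record 'a net =
  places :: "'a set"
  transitions :: "'a set"
  flow :: "'a \<Rightarrow> 'a \<Rightarrow> nat"
  init :: "'a \<Rightarrow> nat"

definition is_marking :: "'a net \<Rightarrow> ('a \<Rightarrow> nat) \<Rightarrow> bool" where
  "is_marking N M \<longleftrightarrow> (\<forall>x. x \<notin> places N \<longrightarrow> M x = 0)"

definition is_net :: "'a net \<Rightarrow> bool" where
  "is_net N \<longleftrightarrow>
     places N \<inter> transitions N = {} \<and>
     (\<forall>x y. (x, y) \<notin> places N \<times> transitions N \<union> transitions N \<times> places N \<longrightarrow> flow N x y = 0) \<and>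
     is_marking N (init N) \<and>
     (\<forall>t \<in> transitions N.
        finite {s \<in> places N. flow N s t > 0} \<and>
        {s \<in> places N. flow N s t > 0} \<noteq> {} \<and>
        finite {s \<in> places N. flow N t s > 0})"

definition pre :: "'a net \<Rightarrow> 'a multiset \<Rightarrow> 'a \<Rightarrow> nat" where
  "pre N G = (\<lambda>s. \<Sum>t\<in>#G. flow N s t)"

definition post :: "'a net \<Rightarrow> 'a multiset \<Rightarrow> 'a \<Rightarrow> nat" where
  "post N G = (\<lambda>s. \<Sum>t\<in>#G. flow N t s)"

definition step :: "'a net \<Rightarrow> ('a \<Rightarrow> nat) \<Rightarrow> 'a multiset \<Rightarrow> ('a \<Rightarrow> nat) \<Rightarrow> bool" where
  "step N M G M' \<longleftrightarrow>
     is_marking N M \<and> is_marking N M' \<and> G \<noteq> {#} \<and> set_mset G \<subseteq> transitions N \<and>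
     pre N G \<le> M \<and> M' = (\<lambda>s. (M s - pre N G s) + post N G s)"

definition step_enabled :: "'a net \<Rightarrow> ('a \<Rightarrow> nat) \<Rightarrow> 'a multiset \<Rightarrow> bool" where
  "step_enabled N M G \<longleftrightarrow> (\<exists>M'. step N M G M')"

primrec fires :: "'a net \<Rightarrow> ('a \<Rightarrow> nat) \<Rightarrow> 'a list \<Rightarrow> ('a \<Rightarrow> nat) \<Rightarrow> bool" where
  "fires N M [] M' \<longleftrightarrow> is_marking N M \<and> M' = M"
| "fires N M (t # \<sigma>) M' \<longleftrightarrow> (\<exists>M1. step N M {#t#} M1 \<and> fires N M1 \<sigma> M')"

datatype 'a seq = Fin "'a list" | Inf "'a stream"

fun fin_prefix :: "'a list \<Rightarrow> 'a seq \<Rightarrow> bool" where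
  "fin_prefix \<sigma> (Fin \<rho>) \<longleftrightarrow> prefix \<sigma> \<rho>"
| "fin_prefix \<sigma> (Inf \<rho>) \<longleftrightarrow> stake (length \<sigma>) \<rho> = \<sigma>"

fun firable :: "'a net \<Rightarrow> ('a \<Rightarrow> nat) \<Rightarrow> 'a seq \<Rightarrow> bool" where
  "firable N M (Fin \<sigma>) \<longleftrightarrow> (\<exists>M'. fires N M \<sigma> M')"
| "firable N M (Inf \<sigma>) \<longleftrightarrow> (\<exists>Ms. Ms 0 = M \<and> (\<forall>i. step N (Ms i) {#\<sigma> !! i#} (Ms (Suc i))))"

definition FS_inf :: "'a net \<Rightarrow> 'a seq set" where
  "FS_inf N = {\<sigma>. firable N (init N) \<sigma>}"

definition FS :: "'a net \<Rightarrow> 'a list set" where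
  "FS N = {\<sigma>. Fin \<sigma> \<in> FS_inf N}"

definition reachable :: "'a net \<Rightarrow> ('a \<Rightarrow> nat) \<Rightarrow> bool" where
  "reachable N M \<longleftrightarrow> (\<exists>\<sigma> \<in> FS N. fires N (init N) \<sigma> M)"

definition in_conflict :: "'a net \<Rightarrow> ('a \<Rightarrow> nat) \<Rightarrow> 'a multiset \<Rightarrow> bool" where
  "in_conflict N M G \<longleftrightarrow>
     G \<noteq> {#} \<and> set_mset G \<subseteq> transitions N \<and>
     \<not> step_enabled N M G \<and> (\<forall>t \<in># G. step_enabled N M {#u \<in># G. u = t#})"

definition binary_conflict_free :: "'a net \<Rightarrow> bool" where
  "binary_conflict_free N \<longleftrightarrow>
     (\<forall>M G. reachable N M \<and> size G = 2 \<longrightarrow> \<not> in_conflict N M G)"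

definition adjacent :: "'a net \<Rightarrow> 'a list \<Rightarrow> 'a list \<Rightarrow> bool" where
  "adjacent N \<sigma> \<rho> \<longleftrightarrow> \<sigma> \<in> FS N \<and> \<rho> \<in> FS N \<and>
     (\<exists>\<sigma>1 t u \<sigma>2 M. \<sigma> = \<sigma>1 @ [t, u] @ \<sigma>2 \<and> \<rho> = \<sigma>1 @ [u, t] @ \<sigma>2 \<and>
        fires N (init N) \<sigma>1 M \<and> step_enabled N M {#t, u#})"

definition seq_le :: "'a net \<Rightarrow> 'a seq \<Rightarrow> 'a seq \<Rightarrow> bool" where
  "seq_le N \<sigma> \<rho> \<longleftrightarrow>
     (\<forall>\<sigma>'' \<in> FS N. fin_prefix \<sigma>'' \<sigma> \<longrightarrow>
        (\<exists>\<sigma>' \<in> FS N. \<exists>\<rho>' \<in> FS N.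
           prefix \<sigma>'' \<sigma>' \<and> (adjacent N)\<^sup>*\<^sup>* \<sigma>' \<rho>' \<and> fin_prefix \<rho>' \<rho>))"

definition seq_equiv :: "'a net \<Rightarrow> ('a seq \<times> 'a seq) set" where
  "seq_equiv N = {(\<sigma>, \<rho>). \<sigma> \<in> FS_inf N \<and> \<rho> \<in> FS_inf N \<and> seq_le N \<sigma> \<rho> \<and> seq_le N \<rho> \<sigma>}"

definition FS_processes :: "'a net \<Rightarrow> 'a seq set set" where
  "FS_processes N = FS_inf N // seq_equiv N"

definition process_le :: "'a net \<Rightarrow> 'a seq set \<Rightarrow> 'a seq set \<Rightarrow> bool" where
  "process_le N P Q \<longleftrightarrow> (\<exists>\<sigma> \<in> P. \<exists>\<rho> \<in> Q. seq_le N \<sigma> \<rho>)"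

definition largest_FS_process :: "'a net \<Rightarrow> 'a seq set \<Rightarrow> bool" where
  "largest_FS_process N P \<longleftrightarrow> P \<in> FS_processes N \<and> (\<forall>Q \<in> FS_processes N. process_le N Q P)"

text \<open>
  \<open>seq_le\<close> is a preorder on \<open>FS_inf\<close>, so \<open>process_le\<close> does not depend on representatives and
  is a partial order on processes.
\<close>

lemma fires_append:
  "fires N M (\<sigma> @ \<rho>) M' \<longleftrightarrow> (\<exists>M1. fires N M \<sigma> M1 \<and> fires N M1 \<rho> M')"
proof (induction \<sigma> arbitrary: M)
  case Nil
  have "is_marking N M" if "fires N M \<rho> M'"
    using that by (cases \<rho>) (auto simp: step_def)
  then show ?case by auto
next
  case (Cons t \<sigma>)
  then show ?case by auto
qed

lemma mem_FS: "\<sigma> \<in> FS N \<longleftrightarrow> (\<exists>M. fires N (init N) \<sigma> M)"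
  by (simp add: FS_def FS_inf_def)

lemma FS_appendD: "\<sigma> @ \<rho> \<in> FS N \<Longrightarrow> \<sigma> \<in> FS N"
  by (auto simp: mem_FS fires_append)

lemma step_det: "step N M G M1 \<Longrightarrow> step N M G M2 \<Longrightarrow> M1 = M2"
  by (simp add: step_def)

lemma fires_det: "fires N M \<sigma> M1 \<Longrightarrow> fires N M \<sigma> M2 \<Longrightarrow> M1 = M2"
  by (induction \<sigma> arbitrary: M) (auto dest: step_det)

lemma fires_marking:
  assumes "fires N M \<sigma> M'"
  shows "\<And>s. int (M' s) = int (M s) + (\<Sum>t\<leftarrow>\<sigma>. int (flow N t s) - int (flow N s t))"
  using assms
proof (induction \<sigma> arbitrary: M)
  case (Cons t \<sigma>)
  then obtain M1 where M1: "step N M {#t#} M1" "fires N M1 \<sigma> M'" by auto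
  have le: "flow N s t \<le> M s" for s
    using M1(1) by (auto simp: step_def pre_def le_fun_def)
  have "M1 s = (M s - flow N s t) + flow N t s" for s
    using M1(1) by (simp add: step_def pre_def post_def)
  then have "int (M1 s) = int (M s) + (int (flow N t s) - int (flow N s t))" for s
    using le[of s] by (metis add_diff_eq add.commute diff_add_eq of_nat_add of_nat_diff)
  with Cons.IH[OF M1(2)] show ?case by simp
qed simp

lemma adjacent_append:
  assumes "adjacent N \<sigma> \<rho>" and "\<sigma> @ \<tau> \<in> FS N"
  shows "adjacent N (\<sigma> @ \<tau>) (\<rho> @ \<tau>)"
proof -
  obtain \<sigma>1 t u \<sigma>2 M where *: "\<sigma> \<in> FS N" "\<rho> \<in> FS N" "\<sigma> = \<sigma>1 @ [t, u] @ \<sigma>2" "\<rho> = \<sigma>1 @ [u, t] @ \<sigma>2"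
    "fires N (init N) \<sigma>1 M" "step_enabled N M {#t, u#}"
    using assms(1) unfolding adjacent_def by blast
  obtain M1 M2 where M12: "fires N (init N) \<sigma> M1" "fires N M1 \<tau> M2"
    using assms(2) by (auto simp: mem_FS fires_append)
  obtain M1' where M1': "fires N (init N) \<rho> M1'"
    using *(2) by (auto simp: mem_FS)
  have "int (M1 s) = int (M1' s)" for s
    using fires_marking[OF M12(1), of s] fires_marking[OF M1', of s] *(3,4) by simp
  then have "M1' = M1" by auto
  with M12 M1' have "\<rho> @ \<tau> \<in> FS N" by (auto simp: mem_FS fires_append)
  moreover have "\<sigma> @ \<tau> = \<sigma>1 @ [t, u] @ (\<sigma>2 @ \<tau>)" "\<rho> @ \<tau> = \<sigma>1 @ [u, t] @ (\<sigma>2 @ \<tau>)"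
    using *(3,4) by simp_all
  ultimately show ?thesis
    using assms(2) *(5,6) unfolding adjacent_def by blast
qed

lemma adjacent_sym: "adjacent N \<sigma> \<rho> \<Longrightarrow> adjacent N \<rho> \<sigma>"
  unfolding adjacent_def by (metis add_mset_commute)

lemma adjacent_rtranclp_append:
  assumes "(adjacent N)\<^sup>*\<^sup>* \<sigma> \<rho>" and "\<sigma> @ \<tau> \<in> FS N"
  shows "(adjacent N)\<^sup>*\<^sup>* (\<sigma> @ \<tau>) (\<rho> @ \<tau>) \<and> \<rho> @ \<tau> \<in> FS N"
  using assms
proof (induction rule: rtranclp_induct)
  case (step \<rho> \<rho>')
  then have "adjacent N (\<rho> @ \<tau>) (\<rho>' @ \<tau>)" using adjacent_append by blast
  with step show ?case by (meson adjacent_def rtranclp.rtrancl_into_rtrancl)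
qed simp

lemma adjacent_rtranclp_sym: "(adjacent N)\<^sup>*\<^sup>* \<sigma> \<rho> \<Longrightarrow> (adjacent N)\<^sup>*\<^sup>* \<rho> \<sigma>"
  by (metis adjacent_sym sympD sympI symp_rtranclp)

lemma seq_le_refl: "seq_le N \<sigma> \<sigma>"
  unfolding seq_le_def by blast

lemma seq_le_trans:
  assumes "seq_le N \<sigma> \<rho>" and "seq_le N \<rho> \<tau>"
  shows "seq_le N \<sigma> \<tau>"
  unfolding seq_le_def
proof (intro ballI impI)
  fix \<sigma>'' assume "\<sigma>'' \<in> FS N" "fin_prefix \<sigma>'' \<sigma>"
  then obtain \<sigma>' \<rho>' where 1: "\<sigma>' \<in> FS N" "\<rho>' \<in> FS N" "prefix \<sigma>'' \<sigma>'" "(adjacent N)\<^sup>*\<^sup>* \<sigma>' \<rho>'"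
    "fin_prefix \<rho>' \<rho>"
    using assms(1) unfolding seq_le_def by blast
  then obtain \<rho>1 \<tau>' where 2: "\<rho>1 \<in> FS N" "\<tau>' \<in> FS N" "prefix \<rho>' \<rho>1" "(adjacent N)\<^sup>*\<^sup>* \<rho>1 \<tau>'"
    "fin_prefix \<tau>' \<tau>"
    using assms(2) unfolding seq_le_def by blast
  obtain \<upsilon> where \<upsilon>: "\<rho>1 = \<rho>' @ \<upsilon>" using 2(3) by (auto simp: prefix_def)
  have 3: "(adjacent N)\<^sup>*\<^sup>* (\<rho>' @ \<upsilon>) (\<sigma>' @ \<upsilon>)" "\<sigma>' @ \<upsilon> \<in> FS N"
    using adjacent_rtranclp_append[OF adjacent_rtranclp_sym[OF 1(4)], of \<upsilon>] 2(1) \<upsilon> by auto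
  have "(adjacent N)\<^sup>*\<^sup>* (\<sigma>' @ \<upsilon>) \<tau>'"
    using adjacent_rtranclp_sym[OF 3(1)] 2(4) \<upsilon> by auto
  moreover have "prefix \<sigma>'' (\<sigma>' @ \<upsilon>)" using 1(3) by (rule prefix_prefix)
  ultimately show "\<exists>\<sigma>' \<in> FS N. \<exists>\<rho>' \<in> FS N.
      prefix \<sigma>'' \<sigma>' \<and> (adjacent N)\<^sup>*\<^sup>* \<sigma>' \<rho>' \<and> fin_prefix \<rho>' \<tau>"
    using 3(2) 2(2,5) by blast
qed

lemma equiv_seq_equiv: "equiv (FS_inf N) (seq_equiv N)"
  by (intro equivI refl_onI symI transI)
     (auto simp: seq_equiv_def seq_le_refl intro: seq_le_trans)

lemma process_le_class:
  assumes "\<sigma> \<in> FS_inf N" and "\<rho> \<in> FS_inf N"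
  shows "process_le N (seq_equiv N `` {\<sigma>}) (seq_equiv N `` {\<rho>}) \<longleftrightarrow> seq_le N \<sigma> \<rho>"
  using assms unfolding process_le_def seq_equiv_def
  by (auto intro: seq_le_refl) (meson seq_le_trans)

lemma process_le_antisym:
  assumes "P \<in> FS_processes N" "Q \<in> FS_processes N" "process_le N P Q" "process_le N Q P"
  shows "P = Q"
proof -
  obtain \<sigma> \<rho> where *: "\<sigma> \<in> FS_inf N" "\<rho> \<in> FS_inf N" "P = seq_equiv N `` {\<sigma>}" "Q = seq_equiv N `` {\<rho>}"
    using assms(1,2) unfolding FS_processes_def by (auto elim!: quotientE)
  then have "(\<sigma>, \<rho>) \<in> seq_equiv N"
    using assms(3,4) process_le_class unfolding seq_equiv_def by blast
  with * show ?thesis using equiv_class_eq[OF equiv_seq_equiv] by simp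
qed

end

theory Submission
  imports Defs
begin

text \<open>
  In a binary-conflict-free net, any two distinct transitions enabled in a reachable marking can be
  swapped, so any two finite firing sequences have extensions that are equivalent under
  \<open>\<equiv>\<^sub>0\<^sup>*\<close>. If some firing sequence ends in a dead marking, every other one can be completed to an
  equivalent of it, so it is largest. Otherwise one enumerates the countably many finite firing
  sequences and builds a strictly increasing chain of firing sequences that absorbs them one by
  one, up to extension and equivalence; its limit is largest.
\<close>

lemma FS_subset_lists: "FS N \<subseteq> lists (transitions N)"
proof -
  have "\<sigma> \<in> lists (transitions N)" if "fires N M \<sigma> M'" for \<sigma> M M'
    using that by (induction \<sigma> arbitrary: M) (auto simp: step_def)
  then show ?thesis by (meson mem_FS subsetI)
qed

lemma Nil_mem_FS: "is_net N \<Longrightarrow> [] \<in> FS N"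
  by (simp add: mem_FS is_net_def)

section \<open>Swapping and confluence of finite firing sequences\<close>

lemma step_pair_fires:
  assumes "step_enabled N M {#t, u#}" "step_enabled N M {#t#}" "step_enabled N M {#u#}"
  shows "\<exists>M'. fires N M [t, u] M'"
proof -
  obtain M1 where M1: "step N M {#t#} M1" using assms(2) by (auto simp: step_enabled_def)
  have le: "flow N s t + flow N s u \<le> M s" for s
    using assms(1) by (auto simp: step_enabled_def step_def pre_def le_fun_def)
  \<comment> \<open>\<open>M2\<close> serves only to locate the outputs of \<open>u\<close>: as a
    marking it vanishes outside \<open>places N\<close>, so \<open>flow N u s = 0\<close> there,
    which makes \<open>M'\<close> a marking.\<close>
  obtain M2 where M2: "step N M {#u#} M2" using assms(3) by (auto simp: step_enabled_def)
  define M' where "M' = (\<lambda>s. (M1 s - flow N s u) + flow N u s)"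
  have M1_eq: "M1 s = (M s - flow N s t) + flow N t s" for s
    using M1 by (simp add: step_def pre_def post_def)
  have "flow N s u \<le> M1 s" for s
    using le[of s] M1_eq[of s] by linarith
  moreover have marking: "is_marking N M1" "is_marking N M2"
    using M1 M2 by (auto simp only: step_def)
  moreover have "is_marking N M'"
    unfolding is_marking_def
  proof (intro allI impI)
    fix s assume "s \<notin> places N"
    then have "M1 s = 0" "M2 s = 0"
      using marking by (auto simp: is_marking_def)
    moreover have "M2 s = (M s - flow N s u) + flow N u s"
      using M2 by (simp add: step_def pre_def post_def)
    ultimately show "M' s = 0" by (simp add: M'_def)
  qed
  moreover have "set_mset {#u#} \<subseteq> transitions N"
    using M1 M2 by (simp_all add: step_def)
  ultimately have "step N M1 {#u#} M'" "is_marking N M'"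
    by (simp_all add: step_def pre_def post_def M'_def le_fun_def)
  then show ?thesis using M1 by auto
qed

text \<open>After \<sigma> both singletons are enabled, so the pair would be in conflict if it were
  not jointly enabled. Distinctness matters: for \<open>t = u\<close> the restriction of the pair to
  \<open>t\<close> is the pair itself, whose enabledness is not given.\<close>

lemma adjacent_swap:
  assumes "binary_conflict_free N" "\<sigma> @ [t] \<in> FS N" "\<sigma> @ [u] \<in> FS N" "t \<noteq> u"
  shows "adjacent N (\<sigma> @ [t, u]) (\<sigma> @ [u, t])"
proof -
  obtain M where M: "fires N (init N) \<sigma> M" "step_enabled N M {#t#}"
    using assms(2) by (auto simp: mem_FS fires_append step_enabled_def)
  have u: "step_enabled N M {#u#}"
    using assms(3) M(1) fires_det by (fastforce simp: mem_FS fires_append step_enabled_def)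
  have "reachable N M"
    using M(1) mem_FS[of \<sigma> N] by (auto simp: reachable_def)
  then have "\<not> in_conflict N M {#t, u#}"
    using assms(1) by (simp add: binary_conflict_free_def)
  moreover have "t \<in> transitions N" "u \<in> transitions N"
    using M(2) u by (auto simp: step_enabled_def step_def)
  ultimately have tu: "step_enabled N M {#t, u#}"
    using M(2) u \<open>t \<noteq> u\<close> by (auto simp: in_conflict_def)
  then have "step_enabled N M {#u, t#}" by (simp add: add_mset_commute)
  then have "\<sigma> @ [t, u] \<in> FS N" "\<sigma> @ [u, t] \<in> FS N"
    using step_pair_fires[of N M] tu M u unfolding mem_FS fires_append by blast+
  then show ?thesis
    unfolding adjacent_def using M(1) tu by (metis append_Nil2)
qed

text \<open>The letter \<open>t\<close> is pushed rightwards through \<open>w\<close> by swaps until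
  it meets an occurrence of itself, and then \<open>z\<close> is empty, or reaches the end of
  \<open>w\<close>, and then \<open>z = [t]\<close>.\<close>

lemma adjacent_confluence_step:
  assumes bcf: "binary_conflict_free N" and "\<sigma> @ [t] \<in> FS N" "\<sigma> @ w \<in> FS N"
  shows "\<exists>v z. \<sigma> @ [t] @ v \<in> FS N \<and> (adjacent N)\<^sup>*\<^sup>* (\<sigma> @ [t] @ v) (\<sigma> @ w @ z)"
  using assms(2,3)
proof (induction w arbitrary: \<sigma>)
  case Nil
  have "\<sigma> @ [t] @ [] \<in> FS N \<and> (adjacent N)\<^sup>*\<^sup>* (\<sigma> @ [t] @ []) (\<sigma> @ [] @ [t])"
    using Nil by simp
  then show ?case by blast
next
  case (Cons u w)
  show ?case
  proof (cases "t = u")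
    case True
    then have "\<sigma> @ [t] @ w \<in> FS N \<and> (adjacent N)\<^sup>*\<^sup>* (\<sigma> @ [t] @ w) (\<sigma> @ (u # w) @ [])"
      using Cons.prems by simp
    then show ?thesis by blast
  next
    case False
    have "\<sigma> @ [u] \<in> FS N"
      using Cons.prems(2) FS_appendD[of "\<sigma> @ [u]" w N] by simp
    then have adj: "adjacent N (\<sigma> @ [u, t]) (\<sigma> @ [t, u])"
      using adjacent_swap[OF bcf] Cons.prems(1) False adjacent_sym by metis
    \<comment> \<open>The swap shows that \<open>u\<close> has not disabled \<open>t\<close>, so the
      induction continues from \<open>\<sigma> @ [u]\<close>.\<close>
    then have "(\<sigma> @ [u]) @ [t] \<in> FS N"
      by (simp add: adjacent_def)
    then obtain v z where vz: "\<sigma> @ [u, t] @ v \<in> FS N"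
        "(adjacent N)\<^sup>*\<^sup>* (\<sigma> @ [u, t] @ v) (\<sigma> @ (u # w) @ z)"
      using Cons.IH[of "\<sigma> @ [u]"] Cons.prems(2) by auto
    have "adjacent N (\<sigma> @ [u, t] @ v) (\<sigma> @ [t, u] @ v)"
      using adjacent_append[OF adj, of v] vz(1) by simp
    then have "adjacent N (\<sigma> @ [t] @ (u # v)) (\<sigma> @ [u, t] @ v)"
      using adjacent_sym by simp
    then have "\<sigma> @ [t] @ (u # v) \<in> FS N"
        "(adjacent N)\<^sup>*\<^sup>* (\<sigma> @ [t] @ (u # v)) (\<sigma> @ (u # w) @ z)"
      using vz(2) by (simp add: adjacent_def, rule converse_rtranclp_into_rtranclp)
    then show ?thesis by blast
  qed
qed

text \<open>One diagram is closed per letter of \<open>a\<close>: the one-letter case turns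
  \<open>w\<close> into a remainder \<open>v\<close> after \<open>t\<close>, and the induction
  hypothesis then compares the rest of \<open>a\<close> with \<open>v\<close>. Hence
  \<open>w\<close> must be generalised. Appending \<open>z'\<close> to the first equivalence lets
  the two compose.\<close>

lemma adjacent_confluence:
  assumes bcf: "binary_conflict_free N" and "\<sigma> @ a \<in> FS N" "\<sigma> @ w \<in> FS N"
  shows "\<exists>v z. \<sigma> @ a @ v \<in> FS N \<and> (adjacent N)\<^sup>*\<^sup>* (\<sigma> @ a @ v) (\<sigma> @ w @ z)"
  using assms(2,3)
proof (induction a arbitrary: \<sigma> w)
  case Nil
  then show ?case by (intro exI[of _ w] exI[of _ "[]"]) simp
next
  case (Cons t a)
  have "\<sigma> @ [t] \<in> FS N"
    using Cons.prems(1) FS_appendD[of "\<sigma> @ [t]" a N] by simp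
  then obtain v z where vz: "\<sigma> @ [t] @ v \<in> FS N" "(adjacent N)\<^sup>*\<^sup>* (\<sigma> @ [t] @ v) (\<sigma> @ w @ z)"
    using adjacent_confluence_step[OF bcf] Cons.prems(2) by blast
  obtain v' z' where 1: "\<sigma> @ (t # a) @ v' \<in> FS N"
      "(adjacent N)\<^sup>*\<^sup>* (\<sigma> @ (t # a) @ v') ((\<sigma> @ [t] @ v) @ z')"
    using Cons.IH[of "\<sigma> @ [t]" v] Cons.prems(1) vz(1) by auto
  have "(\<sigma> @ [t] @ v) @ z' \<in> FS N"
    using adjacent_rtranclp_append[OF 1(2), of "[]"] 1(1) by simp
  then have "(adjacent N)\<^sup>*\<^sup>* ((\<sigma> @ [t] @ v) @ z') ((\<sigma> @ w @ z) @ z')"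
    using adjacent_rtranclp_append[OF vz(2)] by blast
  with 1(2) have "(adjacent N)\<^sup>*\<^sup>* (\<sigma> @ (t # a) @ v') (\<sigma> @ w @ z @ z')"
    by (metis append_assoc rtranclp_trans)
  with 1(1) show ?case by blast
qed

lemma FS_directed:
  assumes "binary_conflict_free N" "\<sigma> \<in> FS N" "\<rho> \<in> FS N"
  obtains \<sigma>' \<rho>' where "\<sigma>' \<in> FS N" "\<rho>' \<in> FS N" "prefix \<sigma> \<sigma>'" "prefix \<rho> \<rho>'"
    "(adjacent N)\<^sup>*\<^sup>* \<sigma>' \<rho>'"
proof -
  obtain v z where vz: "\<sigma> @ v \<in> FS N" "(adjacent N)\<^sup>*\<^sup>* (\<sigma> @ v) (\<rho> @ z)"
    using adjacent_confluence[of N "[]" \<sigma> \<rho>] assms by auto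
  moreover have "\<rho> @ z \<in> FS N"
    using adjacent_rtranclp_append[OF vz(2), of "[]"] vz(1) by simp
  ultimately show ?thesis using that by (meson prefixI)
qed

section \<open>Infinite firing sequences as limits of finite ones\<close>

lemma Inf_mem_FS_inf:
  assumes "\<And>i. stake i \<rho> \<in> FS N"
  shows "Inf \<rho> \<in> FS_inf N"
proof -
  obtain Ms where Ms: "\<And>i. fires N (init N) (stake i \<rho>) (Ms i)"
    using assms unfolding mem_FS by metis
  \<comment> \<open>The markings \<open>Ms i\<close> were chosen separately for each prefix;
    determinism of firing makes them consecutive.\<close>
  have "step N (Ms i) {#\<rho> !! i#} (Ms (Suc i))" for i
  proof -
    obtain M where "fires N (init N) (stake i \<rho>) M" "step N M {#\<rho> !! i#} (Ms (Suc i))"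
      using Ms[of "Suc i"] by (auto simp: stake_Suc fires_append simp del: stake.simps)
    then show ?thesis using fires_det Ms[of i] by metis
  qed
  moreover have "Ms 0 = init N" using Ms[of 0] by simp
  ultimately show ?thesis by (auto simp: FS_inf_def)
qed

lemma increasing_chain_stream:
  fixes r :: "nat \<Rightarrow> 'a list"
  assumes "\<And>n. strict_prefix (r n) (r (Suc n))"
  obtains \<rho> where "\<And>n. stake (length (r n)) \<rho> = r n" "\<And>i. prefix (stake i \<rho>) (r i)"
proof -
  have mono: "prefix (r m) (r n)" if "m \<le> n" for m n
    using that by (induction rule: dec_induct) (auto intro: prefix_order.trans prefix_order.less_imp_le[OF assms])
  have len: "n \<le> length (r n)" for n
  proof (induction n)
    case (Suc n)
    then show ?case using prefix_length_less[OF assms[of n]] by simp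
  qed simp
  \<comment> \<open>Position \<open>i\<close> is read off \<open>r (Suc i)\<close>, the first member
    that \<open>len\<close> guarantees to be long enough.\<close>
  define \<rho> where "\<rho> = smap (\<lambda>i. r (Suc i) ! i) (fromN 0)"
  have nth: "\<rho> !! i = r n ! i" if "i < length (r n)" for i n
  proof -
    have "r n ! i = r (Suc i) ! i"
      using mono[of n "Suc i"] mono[of "Suc i" n] that len[of "Suc i"]
      by (cases "n \<le> Suc i") (auto simp: prefix_def nth_append)
    then show ?thesis by (simp add: \<rho>_def)
  qed
  have pre: "stake i \<rho> = take i (r n)" if "i \<le> length (r n)" for i n
    using that by (intro nth_equalityI) (auto simp: nth)
  show ?thesis
  proof (rule that)
    show "stake (length (r n)) \<rho> = r n" for n
      using pre[of "length (r n)" n] by simp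
    show "prefix (stake i \<rho>) (r i)" for i
      using pre[OF len] take_is_prefix by metis
  qed
qed

section \<open>Construction of a largest process\<close>

lemma seq_leI:
  assumes "\<And>\<sigma>''. \<sigma>'' \<in> FS N \<Longrightarrow>
    \<exists>\<sigma>' \<in> FS N. \<exists>\<rho>' \<in> FS N. prefix \<sigma>'' \<sigma>' \<and> (adjacent N)\<^sup>*\<^sup>* \<sigma>' \<rho>' \<and> fin_prefix \<rho>' \<rho>"
  shows "seq_le N \<sigma> \<rho>"
  using assms unfolding seq_le_def by blast

text \<open>By directedness any finite firing sequence has an extension equivalent to an extension
  of \<rho>, and the latter can only be \<rho> itself. Since all finite firing sequences are
  absorbed, \<sigma> can stay arbitrary.\<close>

lemma dead_sequence_largest:
  assumes "binary_conflict_free N" "\<rho> \<in> FS N" and dead: "\<And>t. \<rho> @ [t] \<notin> FS N"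
  shows "seq_le N \<sigma> (Fin \<rho>)"
proof (rule seq_leI)
  fix \<sigma>'' assume "\<sigma>'' \<in> FS N"
  then obtain \<sigma>' \<rho>' where *: "\<sigma>' \<in> FS N" "\<rho>' \<in> FS N" "prefix \<sigma>'' \<sigma>'" "prefix \<rho> \<rho>'"
      "(adjacent N)\<^sup>*\<^sup>* \<sigma>' \<rho>'"
    using FS_directed[OF assms(1) _ assms(2)] by blast
  have "\<rho>' = \<rho>"
  proof (rule ccontr)
    assume "\<rho>' \<noteq> \<rho>"
    then obtain t z where "\<rho>' = (\<rho> @ [t]) @ z"
      using *(4) by (metis prefixE append_Nil2 append_Cons append_Nil append_assoc neq_Nil_conv)
    then show False using *(2) dead FS_appendD by blast
  qed
  with * show "\<exists>\<sigma>' \<in> FS N. \<exists>\<rho>' \<in> FS N.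
      prefix \<sigma>'' \<sigma>' \<and> (adjacent N)\<^sup>*\<^sup>* \<sigma>' \<rho>' \<and> fin_prefix \<rho>' (Fin \<rho>)"
    by auto
qed

lemma live_net_largest:
  assumes net: "is_net N" "countable (transitions N)" and bcf: "binary_conflict_free N"
    and live: "\<And>\<sigma>. \<sigma> \<in> FS N \<Longrightarrow> \<exists>t. \<sigma> @ [t] \<in> FS N"
  obtains \<rho> where "\<rho> \<in> FS_inf N" "\<And>\<sigma>. seq_le N \<sigma> \<rho>"
proof -
  have count: "countable (FS N)"
    using FS_subset_lists net(2) by (meson countable_lists countable_subset)
  define e where "e = from_nat_into (FS N)"
  have e: "e n \<in> FS N" for n
    using Nil_mem_FS[OF net(1)] from_nat_into[of "FS N"] by (auto simp: e_def)
  \<comment> \<open>This is the witness condition of \<open>seq_le\<close> with all of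
    \<open>r\<close> as \<rho>'; any sequence of which \<open>r\<close> is a prefix then meets
    it.\<close>
  define absorbs where "absorbs \<sigma> r \<longleftrightarrow>
      (\<exists>\<sigma>' \<in> FS N. prefix \<sigma> \<sigma>' \<and> (adjacent N)\<^sup>*\<^sup>* \<sigma>' r)" for \<sigma> r
  have ext: "\<exists>r'. r' \<in> FS N \<and> strict_prefix r r' \<and> absorbs (e n) r'" if r: "r \<in> FS N" for r n
  proof -
    obtain \<sigma>' \<rho>' where *: "\<sigma>' \<in> FS N" "\<rho>' \<in> FS N" "prefix (e n) \<sigma>'" "prefix r \<rho>'"
        "(adjacent N)\<^sup>*\<^sup>* \<sigma>' \<rho>'"
      using FS_directed[OF bcf e r] by blast
    \<comment> \<open>The common extension \<rho>' may equal \<open>r\<close>. One more letter,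
      available by liveness, makes the chain strictly increasing and hence its limit
      infinite.\<close>
    obtain t where t: "\<rho>' @ [t] \<in> FS N" using live[OF *(2)] by blast
    have "(adjacent N)\<^sup>*\<^sup>* (\<rho>' @ [t]) (\<sigma>' @ [t]) \<and> \<sigma>' @ [t] \<in> FS N"
      using adjacent_rtranclp_append[OF adjacent_rtranclp_sym[OF *(5)] t] .
    moreover from this have "(adjacent N)\<^sup>*\<^sup>* (\<sigma>' @ [t]) (\<rho>' @ [t])"
      by (blast intro: adjacent_rtranclp_sym)
    moreover have "prefix (e n) (\<sigma>' @ [t])"
      using *(3) by (rule prefix_prefix)
    ultimately have "absorbs (e n) (\<rho>' @ [t])"
      unfolding absorbs_def by blast
    moreover have "strict_prefix r (\<rho>' @ [t])"
      using *(4) by (auto simp: prefix_def strict_prefix_def)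
    ultimately show ?thesis using t by blast
  qed
  have "\<exists>r. \<forall>n. r n \<in> FS N \<and> strict_prefix (r n) (r (Suc n)) \<and> absorbs (e n) (r (Suc n))"
    using Nil_mem_FS[OF net(1)] ext by (intro dependent_nat_choice) blast+
  then obtain r where r: "\<And>n. r n \<in> FS N"
      "\<And>n. strict_prefix (r n) (r (Suc n)) \<and> absorbs (e n) (r (Suc n))"
    by blast
  obtain \<rho> where \<rho>: "\<And>n. stake (length (r n)) \<rho> = r n" "\<And>i. prefix (stake i \<rho>) (r i)"
    using increasing_chain_stream[of r] r(2) by blast
  show ?thesis
  proof (rule that)
    have "stake i \<rho> \<in> FS N" for i
      using \<rho>(2)[of i] r(1)[of i] FS_appendD by (auto simp: prefix_def)
    then show "Inf \<rho> \<in> FS_inf N" by (rule Inf_mem_FS_inf)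
    show "seq_le N \<sigma> (Inf \<rho>)" for \<sigma>
    proof (rule seq_leI)
      fix \<sigma>'' assume "\<sigma>'' \<in> FS N"
      then obtain n where "\<sigma>'' = e n"
        using from_nat_into_surj[OF count] unfolding e_def by metis
      \<comment> \<open>The sequence \<open>e n\<close> is absorbed by \<open>r (Suc n)\<close>, a
        prefix of the limit.\<close>
      then show "\<exists>\<sigma>' \<in> FS N. \<exists>\<rho>' \<in> FS N.
          prefix \<sigma>'' \<sigma>' \<and> (adjacent N)\<^sup>*\<^sup>* \<sigma>' \<rho>' \<and> fin_prefix \<rho>' (Inf \<rho>)"
        using r(2)[of n] r(1)[of "Suc n"] \<rho>(1)[of "Suc n"] unfolding absorbs_def fin_prefix.simps
        by blast
    qed
  qed
qed

lemma largest_FS_processI: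
  assumes "\<rho> \<in> FS_inf N" "\<And>\<sigma>. \<sigma> \<in> FS_inf N \<Longrightarrow> seq_le N \<sigma> \<rho>"
  shows "largest_FS_process N (seq_equiv N `` {\<rho>})"
  using assms unfolding largest_FS_process_def FS_processes_def
  by (auto intro: quotientI elim!: quotientE simp: process_le_class)

theorem theorem3:
  fixes N :: "'a net"
  assumes "is_net N"
    and "countable (transitions N)"
    and "binary_conflict_free N"
  shows "\<exists>\<rho> \<in> FS_inf N.
           largest_FS_process N (seq_equiv N `` {\<rho>}) \<and> (\<forall>\<sigma> \<in> FS_inf N. seq_le N \<sigma> \<rho>)"
proof -
  obtain \<rho> where "\<rho> \<in> FS_inf N" "\<And>\<sigma>. seq_le N \<sigma> \<rho>"
  proof (cases "\<exists>\<rho> \<in> FS N. \<forall>t. \<rho> @ [t] \<notin> FS N")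
    case True
    then obtain \<rho> where "\<rho> \<in> FS N" "\<And>t. \<rho> @ [t] \<notin> FS N" by blast
    then show ?thesis
      using that[of "Fin \<rho>"] dead_sequence_largest[OF assms(3)] by (simp add: FS_def)
  next
    case False
    then show ?thesis using live_net_largest[OF assms] that by blast
  qed
  then show ?thesis using largest_FS_processI by blast
qed

end
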